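(* Let $K$ be an algebraically closed field of characteristic $0$ and let $B_n:\mathbb{A}^2\to\mathbb{A}^2$ be the $n$th folding map over $K$ associated to the Lie algebra $\mathcal{B}_2$. For all $n\ge2$, $$\operatorname{Aut}(B_n)=\begin{cases}\boldsymbol{\mu}_2&\text{if $n$ is odd},\\ 1&\text{if $n$ is even}.\end{cases}$$ More precisely, when $n$ is odd, the non-trivial element of $\operatorname{Aut}(B_n)$ is $\varphi(x,y)=(-x,y)$.
   Context: $B_n(x,y)=(X_n,Y_n)$ with $X_n,Y_n\in\mathbb{Z}[x,y]$ given by $(X_0,Y_0)=(4,4)$, $(X_1,Y_1)=(x,y)$, $(X_2,Y_2)=(x^2-2y-4,\ y^2-2x^2+4y+4)$, $(X_3,Y_3)=(x^3-3xy-3x,\ y^3-3x^2y+6y^2+9y)$, and for $n\ge0$ $$X_{n+4}=x(X_{n+3}+X_{n+1})-(2+y)X_{n+2}-X_n,\qquad Y_{n+4}=y(Y_{n+3}+Y_{n+1})-(x^2-2y-2)Y_{n+2}-Y_n.$$ $\operatorname{Aut}(B_n)$ is the group of affine automorphisms $\varphi(x,y)=(ax+by+c,\,dx+ey+f)$ of $\mathbb{A}^2$ (coefficients in $K$, $ae-bd\ne0$) satisfying $\varphi^{-1}\circ B_n\circ\varphi=B_n$. $\boldsymbol{\mu}_2$ denotes the cyclic group of order 2 and $1$ the trivial group. *)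

theory Defs
  imports
    "HOL-Algebra.Elementary_Groups"
    "HOL-Computational_Algebra.Polynomial"
begin

text \<open>
  \<open>\<int>[x, y]\<close> is represented as \<open>int poly poly\<close>, that is \<open>\<int>[x][y]\<close>: the outer variable is \<open>y\<close>,
  and \<open>x\<close> is a constant of the outer polynomial ring.
\<close>

definition Xvar :: "int poly poly" where "Xvar = [:[:0, 1:]:]"

definition Yvar :: "int poly poly" where "Yvar = [:0, 1:]"

definition eval2 :: "int poly poly \<Rightarrow> 'a::comm_ring_1 \<Rightarrow> 'a \<Rightarrow> 'a" where
  "eval2 P x y = poly (map_poly (\<lambda>p. poly (map_poly of_int p) x) P) y"

fun B2_X :: "nat \<Rightarrow> int poly poly" where
  "B2_X 0 = 4"
| "B2_X (Suc 0) = Xvar"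
| "B2_X (Suc (Suc 0)) = Xvar ^ 2 - 2 * Yvar - 4"
| "B2_X (Suc (Suc (Suc 0))) = Xvar ^ 3 - 3 * Xvar * Yvar - 3 * Xvar"
| "B2_X (Suc (Suc (Suc (Suc n)))) =
     Xvar * (B2_X (Suc (Suc (Suc n))) + B2_X (Suc n))
       - (2 + Yvar) * B2_X (Suc (Suc n)) - B2_X n"

fun B2_Y :: "nat \<Rightarrow> int poly poly" where
  "B2_Y 0 = 4"
| "B2_Y (Suc 0) = Yvar"
| "B2_Y (Suc (Suc 0)) = Yvar ^ 2 - 2 * Xvar ^ 2 + 4 * Yvar + 4"
| "B2_Y (Suc (Suc (Suc 0))) = Yvar ^ 3 - 3 * Xvar ^ 2 * Yvar + 6 * Yvar ^ 2 + 9 * Yvar"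
| "B2_Y (Suc (Suc (Suc (Suc n)))) =
     Yvar * (B2_Y (Suc (Suc (Suc n))) + B2_Y (Suc n))
       - (Xvar ^ 2 - 2 * Yvar - 2) * B2_Y (Suc (Suc n)) - B2_Y n"

lemma eval2_vars [simp]: "eval2 Xvar x y = x" "eval2 Yvar x y = y"
  by (simp_all add: eval2_def Xvar_def Yvar_def map_poly_pCons)

text \<open>
  A morphism \<open>\<A>\<^sup>2 \<rightarrow> \<A>\<^sup>2\<close> over an algebraically closed field is identified with the map it induces
  on the points \<open>K \<times> K\<close>; the map determines the morphism, since \<open>K\<close> is infinite.
\<close>

definition folding_map :: "nat \<Rightarrow> 'a::comm_ring_1 \<times> 'a \<Rightarrow> 'a \<times> 'a" where
  "folding_map n = (\<lambda>(x, y). (eval2 (B2_X n) x y, eval2 (B2_Y n) x y))"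

definition affine_automorphisms :: "('a::field \<times> 'a \<Rightarrow> 'a \<times> 'a) set" where
  "affine_automorphisms =
     {\<phi>. \<exists>a b c d e f. a * e - b * d \<noteq> 0 \<and>
          \<phi> = (\<lambda>(x, y). (a * x + b * y + c, d * x + e * y + f))}"

definition Aut_group :: "('a::field \<times> 'a \<Rightarrow> 'a \<times> 'a) \<Rightarrow> ('a \<times> 'a \<Rightarrow> 'a \<times> 'a) monoid" where
  "Aut_group B =
     \<lparr>carrier = {\<phi> \<in> affine_automorphisms. inv_into UNIV \<phi> \<circ> B \<circ> \<phi> = B},
      monoid.mult = (\<circ>), one = id\<rparr>"

lemma id_affine: "id \<in> affine_automorphisms"
  unfolding affine_automorphisms_def
  by (rule CollectI, rule exI[of _ 1], rule exI[of _ 0], rule exI[of _ 0],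
      rule exI[of _ 0], rule exI[of _ 1], rule exI[of _ 0]) auto

lemma comp_affine:
  assumes "\<phi> \<in> affine_automorphisms" "\<psi> \<in> affine_automorphisms"
  shows "\<phi> \<circ> \<psi> \<in> affine_automorphisms"
proof -
  from assms(1) obtain a b c d e f where 1: "a * e - b * d \<noteq> 0"
    "\<phi> = (\<lambda>(x, y). (a * x + b * y + c, d * x + e * y + f))"
    unfolding affine_automorphisms_def by auto
  from assms(2) obtain a' b' c' d' e' f' where 2: "a' * e' - b' * d' \<noteq> 0"
    "\<psi> = (\<lambda>(x, y). (a' * x + b' * y + c', d' * x + e' * y + f'))"
    unfolding affine_automorphisms_def by auto
  have det: "(a*a' + b*d') * (d*b' + e*e') - (a*b' + b*e') * (d*a' + e*d')
      = (a * e - b * d) * (a' * e' - b' * d')"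
    by (simp add: algebra_simps)
  have eq: "\<phi> \<circ> \<psi> = (\<lambda>(x, y). ((a*a' + b*d') * x + (a*b' + b*e') * y + (a*c' + b*f' + c),
      (d*a' + e*d') * x + (d*b' + e*e') * y + (d*c' + e*f' + f)))"
    by (auto simp: 1(2) 2(2) fun_eq_iff algebra_simps)
  have "(a*a' + b*d') * (d*b' + e*e') - (a*b' + b*e') * (d*a' + e*d') \<noteq> 0"
    unfolding det using 1(1) 2(1) by simp
  with eq show ?thesis unfolding affine_automorphisms_def by blast
qed

lemma affine_inverse:
  assumes "\<phi> \<in> affine_automorphisms"
  obtains \<psi> where "\<psi> \<in> affine_automorphisms" "\<psi> \<circ> \<phi> = id" "\<phi> \<circ> \<psi> = id"
proof -
  from assms obtain a b c d e f where 1: "a * e - b * d \<noteq> 0"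
    "\<phi> = (\<lambda>(x, y). (a * x + b * y + c, d * x + e * y + f))"
    unfolding affine_automorphisms_def by auto
  define D where "D = a * e - b * d"
  have D: "D \<noteq> 0" using 1 D_def by simp
  define \<psi> where "\<psi> = (\<lambda>(x, y). ((e/D) * x + (-b/D) * y + (b*f - e*c)/D,
                               (-d/D) * x + (a/D) * y + (d*c - a*f)/D))"
  have "(e/D) * (a/D) - (-b/D) * (-d/D) = (a * e - b * d) / (D * D)"
    by (simp add: diff_divide_distrib mult.commute)
  also have "\<dots> \<noteq> 0" using D D_def by simp
  finally have "\<psi> \<in> affine_automorphisms"
    unfolding affine_automorphisms_def \<psi>_def by blast
  moreover have "\<psi> \<circ> \<phi> = id"
  proof (rule ext, clarify)
    fix x y
    have "(e * (a*x + b*y + c) - b * (d*x + e*y + f) + (b*f - e*c)) = D * x"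
         "(- d * (a*x + b*y + c) + a * (d*x + e*y + f) + (d*c - a*f)) = D * y"
      by (simp_all add: D_def algebra_simps)
    then show "(\<psi> \<circ> \<phi>) (x, y) = id (x, y)"
      using D by (simp add: \<psi>_def 1(2) divide_simps)
  qed
  moreover have "\<phi> \<circ> \<psi> = id"
  proof (rule ext, clarify)
    fix x y
    have "a * ((e/D) * x + (-b/D) * y + (b*f - e*c)/D) + b * ((-d/D) * x + (a/D) * y + (d*c - a*f)/D)
        = (D * (x - c)) / D"
      "d * ((e/D) * x + (-b/D) * y + (b*f - e*c)/D) + e * ((-d/D) * x + (a/D) * y + (d*c - a*f)/D)
        = (D * (y - f)) / D"
      by (simp_all add: D_def add_divide_distrib diff_divide_distrib algebra_simps)
    then show "(\<phi> \<circ> \<psi>) (x, y) = id (x, y)"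
      using D by (simp add: \<psi>_def 1(2))
  qed
  ultimately show thesis by (rule that)
qed

lemma affine_bij: "\<phi> \<in> affine_automorphisms \<Longrightarrow> bij \<phi>"
  by (metis affine_inverse o_bij)

lemma Aut_commute_iff:
  assumes "\<phi> \<in> affine_automorphisms"
  shows "inv_into UNIV \<phi> \<circ> B \<circ> \<phi> = B \<longleftrightarrow> B \<circ> \<phi> = \<phi> \<circ> B"
proof -
  have b: "bij \<phi>" using assms by (rule affine_bij)
  then have "inv_into UNIV \<phi> (B (\<phi> z)) = B z \<longleftrightarrow> B (\<phi> z) = \<phi> (B z)" for z
    by (metis bij_inv_eq_iff)
  then show ?thesis by (auto simp: fun_eq_iff)
qed

lemma group_Aut_group: "group (Aut_group B)"
proof (rule groupI)
  have c: "carrier (Aut_group B) = {\<phi> \<in> affine_automorphisms. B \<circ> \<phi> = \<phi> \<circ> B}"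
    by (auto simp: Aut_group_def Aut_commute_iff)
  show "\<one>\<^bsub>Aut_group B\<^esub> \<in> carrier (Aut_group B)"
    unfolding c by (simp add: Aut_group_def id_affine)
  fix \<phi> assume p: "\<phi> \<in> carrier (Aut_group B)"
  show "\<one>\<^bsub>Aut_group B\<^esub> \<otimes>\<^bsub>Aut_group B\<^esub> \<phi> = \<phi>" by (simp add: Aut_group_def)
  from p obtain \<psi> where q: "\<psi> \<in> affine_automorphisms" "\<psi> \<circ> \<phi> = id" "\<phi> \<circ> \<psi> = id"
    unfolding c using affine_inverse by blast
  have comm: "B (\<phi> z) = \<phi> (B z)" for z
    using p unfolding c by (metis (mono_tags, lifting) comp_apply mem_Collect_eq)
  have "B (\<psi> z) = \<psi> (B z)" for z
    by (metis comm q(2,3) comp_apply id_apply)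
  then have "\<psi> \<in> carrier (Aut_group B)" unfolding c using q(1) by auto
  then show "\<exists>\<psi>\<in>carrier (Aut_group B). \<psi> \<otimes>\<^bsub>Aut_group B\<^esub> \<phi> = \<one>\<^bsub>Aut_group B\<^esub>"
    using q(2) by (auto simp: Aut_group_def)
  fix \<psi>' assume p': "\<psi>' \<in> carrier (Aut_group B)"
  have "B \<circ> (\<phi> \<circ> \<psi>') = (\<phi> \<circ> \<psi>') \<circ> B"
    using p p' unfolding c by (metis (mono_tags, lifting) comp_assoc mem_Collect_eq)
  then have "\<phi> \<circ> \<psi>' \<in> carrier (Aut_group B)"
    using p p' comp_affine unfolding c by blast
  then show "\<phi> \<otimes>\<^bsub>Aut_group B\<^esub> \<psi>' \<in> carrier (Aut_group B)"
    by (simp add: Aut_group_def)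
  fix \<chi>
  show "\<phi> \<otimes>\<^bsub>Aut_group B\<^esub> \<psi>' \<otimes>\<^bsub>Aut_group B\<^esub> \<chi> = \<phi> \<otimes>\<^bsub>Aut_group B\<^esub> (\<psi>' \<otimes>\<^bsub>Aut_group B\<^esub> \<chi>)"
    by (simp add: Aut_group_def comp_assoc)
qed

end

theory Submission
  imports Defs
begin

text \<open>
  An affine \<open>\<phi> = (a x + b y + c, d x + e y + f)\<close> commuting with the folding map gives, along every
  line \<open>(\<gamma> + \<alpha> t, \<delta> + \<beta> t)\<close>, an identity of polynomials in \<open>t\<close>, of which only the top three
  coefficients matter. On vertical lines, the coefficients of \<open>t\<^sup>n\<close> and \<open>t\<^sup>n\<^sup>-\<^sup>1\<close> give \<open>b = 0\<close> or \<open>a = 0\<close>;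
  if \<open>b \<noteq> 0\<close>, then along the line \<open>y = 2 x\<close>, where the leading form of \<open>Y\<^sub>n\<close> is \<open>2 t\<^sup>n\<close>, one would have
  \<open>2\<^sup>n = 2\<close>. With \<open>b = 0\<close>, the same two coefficients give \<open>d = 0\<close> and \<open>f = 2 e - 2\<close> on vertical
  lines, and then \<open>c = 0\<close> and \<open>e = a\<^sup>2\<close> on the lines \<open>y = \<beta> x\<close>. Finally
  the coefficient of \<open>t\<^sup>n\<^sup>-\<^sup>2\<close> in \<open>Y\<^sub>n(\<gamma>, t)\<close> depends on \<open>\<gamma>\<close> through \<open>- n \<gamma>\<^sup>2\<close>, which gives \<open>a\<^sup>2 = e\<^sup>2\<close>.
  Hence \<open>\<phi> = (\<plusminus>x, y)\<close>, and the sign \<open>-\<close> occurs exactly for odd \<open>n\<close>.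
\<close>

section \<open>Evaluation of integer polynomials as a ring homomorphism\<close>

lemma eval2_0: "eval2 0 x y = 0" for x y :: "'a::comm_ring_1"
  by (simp add: eval2_def)

lemma eval2_pCons: "eval2 (pCons p P) x y = poly (map_poly of_int p) x + y * eval2 P x y"
  for x y :: "'a::comm_ring_1"
  by (simp add: eval2_def map_poly_pCons)

lemma map_poly_of_int_smult:
  "map_poly of_int (smult c q) = smult (of_int c) (map_poly of_int q :: 'a::comm_ring_1 poly)"
  by (rule poly_eqI) (simp add: coeff_map_poly)

lemma map_poly_of_int_add:
  "map_poly of_int (p + q) = (map_poly of_int p + map_poly of_int q :: 'a::comm_ring_1 poly)"
  by (rule poly_eqI) (simp add: coeff_map_poly)

lemma map_poly_of_int_mult:
  "map_poly of_int (p * q) = (map_poly of_int p * map_poly of_int q :: 'a::comm_ring_1 poly)"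
  by (induction p) (simp_all add: map_poly_pCons map_poly_of_int_smult map_poly_of_int_add)

lemma eval2_add: "eval2 (P + Q) x y = eval2 P x y + eval2 Q x (y::'a::comm_ring_1)"
proof -
  have "map_poly (\<lambda>p. poly (map_poly of_int p) x) (P + Q) =
      map_poly (\<lambda>p. poly (map_poly of_int p) x) P + map_poly (\<lambda>p. poly (map_poly of_int p) x) Q"
    by (intro poly_eqI) (simp add: coeff_map_poly map_poly_of_int_add)
  then show ?thesis
    by (simp add: eval2_def)
qed

lemma eval2_smult:
  "eval2 (smult p Q) x y = poly (map_poly of_int p) x * eval2 Q x (y::'a::comm_ring_1)"
  by (induction Q) (simp_all add: eval2_0 eval2_pCons map_poly_of_int_mult algebra_simps)

lemma eval2_mult: "eval2 (P * Q) x y = eval2 P x y * eval2 Q x (y::'a::comm_ring_1)"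
  by (induction P) (simp_all add: eval2_0 eval2_pCons eval2_add eval2_smult algebra_simps)

lemma eval2_of_int: "eval2 (of_int k) x y = of_int k" for x y :: "'a::comm_ring_1"
  by (simp add: of_int_poly eval2_0 eval2_pCons map_poly_pCons)

lemma eval2_1: "eval2 1 x y = 1" for x y :: "'a::comm_ring_1"
  using eval2_of_int[of 1 x y] by simp

lemma eval2_numeral: "eval2 (numeral k) x y = numeral k" for x y :: "'a::comm_ring_1"
  using eval2_of_int[of "numeral k" x y] by simp

lemma eval2_diff: "eval2 (P - Q) x y = eval2 P x y - eval2 Q x (y::'a::comm_ring_1)"
  using eval2_add[of "P - Q" Q x y] by simp

lemma eval2_power: "eval2 (P ^ k) x y = eval2 P x y ^ k" for x y :: "'a::comm_ring_1"
  by (induction k) (simp_all add: eval2_1 eval2_mult)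

lemmas eval2_simps = eval2_add eval2_diff eval2_mult eval2_power eval2_numeral

section \<open>The evaluated recurrences and their parity in \<open>x\<close>\<close>

abbreviation evX :: "nat \<Rightarrow> 'a::comm_ring_1 \<Rightarrow> 'a \<Rightarrow> 'a" where
  "evX n \<equiv> eval2 (B2_X n)"

abbreviation evY :: "nat \<Rightarrow> 'a::comm_ring_1 \<Rightarrow> 'a \<Rightarrow> 'a" where
  "evY n \<equiv> eval2 (B2_Y n)"

lemma evX_simps:
  fixes x y :: "'a::comm_ring_1"
  shows "evX 0 x y = 4" "evX (Suc 0) x y = x" "evX (Suc (Suc 0)) x y = x\<^sup>2 - 2 * y - 4"
    "evX (Suc (Suc (Suc 0))) x y = x ^ 3 - 3 * x * y - 3 * x"
    "evX (Suc (Suc (Suc (Suc n)))) x y =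
       x * (evX (Suc (Suc (Suc n))) x y + evX (Suc n) x y) - (2 + y) * evX (Suc (Suc n)) x y
         - evX n x y"
  by (simp_all add: eval2_simps)

lemma evY_simps:
  fixes x y :: "'a::comm_ring_1"
  shows "evY 0 x y = 4" "evY (Suc 0) x y = y"
    "evY (Suc (Suc 0)) x y = y\<^sup>2 - 2 * x\<^sup>2 + 4 * y + 4"
    "evY (Suc (Suc (Suc 0))) x y = y ^ 3 - 3 * x\<^sup>2 * y + 6 * y\<^sup>2 + 9 * y"
    "evY (Suc (Suc (Suc (Suc n)))) x y =
       y * (evY (Suc (Suc (Suc n))) x y + evY (Suc n) x y)
         - (x\<^sup>2 - 2 * y - 2) * evY (Suc (Suc n)) x y - evY n x y"
  by (simp_all add: eval2_simps)

declare B2_X.simps [simp del] B2_Y.simps [simp del]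

text \<open>\<open>evX\<close> makes sense over any commutative ring, so inserting polynomials in t
  restricts it to a curve. Evaluation at t is a ring homomorphism and hence respects the
  recurrence.\<close>

lemma poly_evX: "poly (evX n P Q) t = evX n (poly P t) (poly Q t)"
  by (induction n rule: B2_X.induct) (simp_all add: evX_simps)

lemma poly_evY: "poly (evY n P Q) t = evY n (poly P t) (poly Q t)"
  by (induction n rule: B2_Y.induct) (simp_all add: evY_simps)

text \<open>The odd factor \<open>x\<close> stands in the recurrence exactly at the terms whose
  index differs from n + 4 by an odd number.\<close>

lemma evX_uminus: "evX n (- x) y = (- 1) ^ n * evX n x y" for x y :: "'a::comm_ring_1"
  by (induction n rule: B2_X.induct) (simp_all add: evX_simps power3_eq_cube algebra_simps)

lemma evY_uminus: "evY n (- x) y = evY n x y" for x y :: "'a::comm_ring_1"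
  by (induction n rule: B2_Y.induct) (simp_all add: evY_simps)

section \<open>Leading coefficients along lines\<close>

lemma coeff_evX_eq_0: "k > n \<Longrightarrow> coeff (evX n [:\<gamma>, \<alpha>:] [:\<delta>, \<beta>:]) k = 0"
  for \<alpha> \<beta> \<gamma> \<delta> :: "'a::comm_ring_1"
  by (induction n arbitrary: k rule: B2_X.induct)
    (auto simp: evX_simps numeral_poly power2_eq_square power3_eq_cube coeff_pCons algebra_simps
      split: nat.split)

lemma coeff_evY_eq_0: "k > n \<Longrightarrow> coeff (evY n [:\<gamma>, \<alpha>:] [:\<delta>, \<beta>:]) k = 0"
  for \<alpha> \<beta> \<gamma> \<delta> :: "'a::comm_ring_1"
  by (induction n arbitrary: k rule: B2_Y.induct)
    (auto simp: evY_simps numeral_poly power2_eq_square power3_eq_cube coeff_pCons algebra_simps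
      split: nat.split)

text \<open>Only \<open>x\<close> times the previous term reaches the top degree. One degree lower,
  \<open>y\<close> times the term two indices back also contributes, which brings in
  \<beta>.\<close>

lemma coeff_evX_line:
  fixes \<alpha> \<beta> \<gamma> \<delta> :: "'a::comm_ring_1"
  defines "F \<equiv> \<lambda>n. evX n [:\<gamma>, \<alpha>:] [:\<delta>, \<beta>:]"
  shows "coeff (F (m + 2)) (m + 2) = \<alpha> ^ (m + 2) \<and>
         coeff (F (m + 2)) (m + 1) = of_nat (m + 2) * (\<alpha> ^ (m + 1) * \<gamma> - \<alpha> ^ m * \<beta>)"
proof (induction m rule: induct_nat_012)
  case (ge2 m)
  have "coeff (F (m + 4)) (m + 4) = \<alpha> * coeff (F (Suc m + 2)) (Suc m + 2)"
    "coeff (F (m + 4)) (m + 3) = \<gamma> * coeff (F (Suc m + 2)) (Suc m + 2)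
       + \<alpha> * coeff (F (Suc m + 2)) (Suc m + 1) - \<beta> * coeff (F (m + 2)) (m + 2)"
    using coeff_evX_eq_0[of _ _ \<gamma> \<alpha> \<delta> \<beta>]
    by (simp_all add: F_def evX_simps numeral_poly algebra_simps eval_nat_numeral)
  note rec = this[unfolded ge2(1)[THEN conjunct1] ge2(2)[THEN conjunct1] ge2(2)[THEN conjunct2]]
  show ?case
    using rec by (simp add: algebra_simps eval_nat_numeral)
qed (simp_all add: F_def evX_simps numeral_poly power2_eq_square power3_eq_cube eval_nat_numeral
  coeff_pCons algebra_simps)

text \<open>With \<open>x\<close> constant, the \<open>x\<^sup>2\<close> term of the recurrence
  falls two degrees below the top, so neither coefficient sees \<gamma>. The 2 in \<delta> + 2 stems
  from the summand \<open>2 * y\<close> of the recurrence.\<close>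

lemma coeff_evY_vertical_line:
  fixes \<beta> \<gamma> \<delta> :: "'a::comm_ring_1"
  defines "F \<equiv> \<lambda>n. evY n [:\<gamma>:] [:\<delta>, \<beta>:]"
  shows "coeff (F (m + 2)) (m + 2) = \<beta> ^ (m + 2) \<and>
         coeff (F (m + 2)) (m + 1) = of_nat (m + 2) * \<beta> ^ (m + 1) * (\<delta> + 2)"
proof (induction m rule: induct_nat_012)
  case (ge2 m)
  then show ?case
    using coeff_evY_eq_0[of _ _ \<gamma> 0 \<delta> \<beta>]
    by (simp add: F_def evY_simps numeral_poly power2_eq_square algebra_simps)
qed (simp_all add: F_def evY_simps numeral_poly power2_eq_square power3_eq_cube eval_nat_numeral
  coeff_pCons algebra_simps)

text \<open>The leading coefficients satisfy u(n+2) = 2 \<alpha> u(n+1) - \<alpha>^2 u(n), with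
  double characteristic root \<alpha>. The starting values 2 \<alpha>^2 and 2 \<alpha>^3 select the
  pure power.\<close>

lemma coeff_evY_slope2_line:
  fixes \<alpha> \<gamma> \<delta> :: "'a::comm_ring_1"
  defines "F \<equiv> \<lambda>n. evY n [:\<gamma>, \<alpha>:] [:\<delta>, 2 * \<alpha>:]"
  shows "coeff (F (m + 2)) (m + 2) = 2 * \<alpha> ^ (m + 2)"
proof (induction m rule: induct_nat_012)
  case (ge2 m)
  then show ?case
    using coeff_evY_eq_0[of _ _ \<gamma> \<alpha> \<delta> "2 * \<alpha>"]
    by (simp add: F_def evY_simps numeral_poly power2_eq_square algebra_simps)
qed (simp_all add: F_def evY_simps numeral_poly power2_eq_square power3_eq_cube eval_nat_numeral
  coeff_pCons algebra_simps)

text \<open>The recurrence involves \<open>x\<close> only through \<open>x\<^sup>2\<close> times the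
  term two indices back, so any dependence on \<gamma> costs two degrees.\<close>

lemma coeff_evY_vertical_diff_eq_0:
  fixes \<beta> \<gamma> \<delta> :: "'a::comm_ring_1"
  shows "n < k + 2 \<Longrightarrow> coeff (evY n [:\<gamma>:] [:\<delta>, \<beta>:]) k = coeff (evY n 0 [:\<delta>, \<beta>:]) k"
proof (induction n arbitrary: k rule: B2_Y.induct)
  case (5 n)
  then show ?case
    using coeff_evY_eq_0[of "n + 2" k \<gamma> 0 \<delta> \<beta>]
    by (auto simp: evY_simps numeral_poly power2_eq_square coeff_pCons algebra_simps split: nat.split)
qed (auto simp: evY_simps numeral_poly power2_eq_square power3_eq_cube coeff_pCons algebra_simps
      split: nat.split)

text \<open>Each step multiplies the difference by \<beta> and adds -\<gamma>^2 times the leading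
  coefficient of the term two indices back; the start is -2 \<gamma>^2 at m = 0.\<close>

lemma coeff_evY_vertical_diff:
  fixes \<beta> \<gamma> \<delta> :: "'a::comm_ring_1"
  shows "coeff (evY (m + 2) [:\<gamma>:] [:\<delta>, \<beta>:]) m =
    coeff (evY (m + 2) 0 [:\<delta>, \<beta>:]) m - of_nat (m + 2) * \<gamma>\<^sup>2 * \<beta> ^ m"
proof (induction m rule: induct_nat_012)
  case (ge2 m)
  have "coeff (evY (m + 4) [:\<gamma>:] [:\<delta>, \<beta>:]) (m + 2) - coeff (evY (m + 4) 0 [:\<delta>, \<beta>:]) (m + 2) =
      \<beta> * (coeff (evY (Suc m + 2) [:\<gamma>:] [:\<delta>, \<beta>:]) (Suc m)
        - coeff (evY (Suc m + 2) 0 [:\<delta>, \<beta>:]) (Suc m)) - \<gamma>\<^sup>2 * \<beta> ^ (m + 2)"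
    using coeff_evY_vertical_diff_eq_0[of _ _ \<gamma> \<delta> \<beta>] coeff_evY_vertical_line[of m \<gamma> \<delta> \<beta>]
    by (simp add: evY_simps numeral_poly power2_eq_square algebra_simps eval_nat_numeral)
  then show ?case
    unfolding ge2(2) by (simp add: algebra_simps eval_nat_numeral)
qed (simp_all add: evY_simps numeral_poly power2_eq_square power3_eq_cube eval_nat_numeral
  coeff_pCons algebra_simps)

section \<open>Affine maps commuting with a folding map\<close>

lemma commuting_affine_on_lines:
  fixes a b c d e f :: "'a::{idom, ring_char_0}"
  assumes comm: "folding_map n \<circ> (\<lambda>(x, y). (a * x + b * y + c, d * x + e * y + f)) =
    (\<lambda>(x, y). (a * x + b * y + c, d * x + e * y + f)) \<circ> folding_map n"
  shows "evX n [:a * \<gamma> + b * \<delta> + c, a * \<alpha> + b * \<beta>:] [:d * \<gamma> + e * \<delta> + f, d * \<alpha> + e * \<beta>:] =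
      smult a (evX n [:\<gamma>, \<alpha>:] [:\<delta>, \<beta>:]) + smult b (evY n [:\<gamma>, \<alpha>:] [:\<delta>, \<beta>:]) + [:c:]" (is ?X)
    and "evY n [:a * \<gamma> + b * \<delta> + c, a * \<alpha> + b * \<beta>:] [:d * \<gamma> + e * \<delta> + f, d * \<alpha> + e * \<beta>:] =
      smult d (evX n [:\<gamma>, \<alpha>:] [:\<delta>, \<beta>:]) + smult e (evY n [:\<gamma>, \<alpha>:] [:\<delta>, \<beta>:]) + [:f:]" (is ?Y)
proof -
  have pt: "evX n (a * x + b * y + c) (d * x + e * y + f) = a * evX n x y + b * evY n x y + c \<and>
            evY n (a * x + b * y + c) (d * x + e * y + f) = d * evX n x y + e * evY n x y + f" for x y
    using fun_cong[OF comm, of "(x, y)"] by (simp add: folding_map_def)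
  have "poly [:a * \<gamma> + b * \<delta> + c, a * \<alpha> + b * \<beta>:] t = a * (\<gamma> + t * \<alpha>) + b * (\<delta> + t * \<beta>) + c"
       "poly [:d * \<gamma> + e * \<delta> + f, d * \<alpha> + e * \<beta>:] t = d * (\<gamma> + t * \<alpha>) + e * (\<delta> + t * \<beta>) + f" for t
    by (simp_all add: algebra_simps)
  note lines = this
  \<comment> \<open>The affine map sends lines to lines, so both sides are polynomials in t that
    agree at every point; over a domain of characteristic 0 they are equal.\<close>
  show ?X
    unfolding poly_eq_poly_eq_iff[symmetric] fun_eq_iff poly_evX lines
    by (simp add: pt poly_evX poly_evY)
  show ?Y
    unfolding poly_eq_poly_eq_iff[symmetric] fun_eq_iff poly_evY lines
    by (simp add: pt poly_evX poly_evY)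
qed

lemma commuting_affine_cases:
  fixes a b c d e f :: "'a::field_char_0"
  assumes comm: "folding_map n \<circ> (\<lambda>(x, y). (a * x + b * y + c, d * x + e * y + f)) =
      (\<lambda>(x, y). (a * x + b * y + c, d * x + e * y + f)) \<circ> folding_map n"
    and det: "a * e - b * d \<noteq> 0" and "n \<ge> 2"
  shows "b = 0 \<and> c = 0 \<and> d = 0 \<and> e = 1 \<and> f = 0 \<and> a\<^sup>2 = 1"
proof -
  obtain m where n: "n = m + 2"
    using \<open>n \<ge> 2\<close> by (metis add.commute le_Suc_ex)
  have N: "of_nat (m + 2) \<noteq> (0::'a)"
    by (metis add_2_eq_Suc' of_nat_neq_0)
  note X = commuting_affine_on_lines(1)[OF comm, unfolded n]
  note Y = commuting_affine_on_lines(2)[OF comm, unfolded n]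
  note cX = coeff_evX_line[THEN conjunct1] coeff_evX_line[THEN conjunct2]
  note cY = coeff_evY_vertical_line[THEN conjunct1] coeff_evY_vertical_line[THEN conjunct2]
  \<comment> \<open>The power \<open>0 ^ m\<close> is 1 for m = 0: the summand -2 y of the second
    \<open>X\<close> is still visible on vertical lines.\<close>
  have cXv: "coeff (evX (m + 2) [:\<gamma>:] [:0, 1:]) (m + 2) = 0"
    "coeff (evX (m + 2) [:\<gamma>:] [:0, 1:]) (m + 1) = - of_nat (m + 2) * 0 ^ m" for \<gamma> :: 'a
    using coeff_evX_line[of m \<gamma> 0 0 1] by (simp_all add: algebra_simps)
  have const: "coeff [:u:] (m + 2) = 0" "coeff [:u:] (m + 1) = 0" for u :: 'a
    by simp_all
  have Xv: "evX (m + 2) [:a * \<gamma> + c, b:] [:d * \<gamma> + f, e:] =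
      smult a (evX (m + 2) [:\<gamma>:] [:0, 1:]) + smult b (evY (m + 2) [:\<gamma>:] [:0, 1:]) + [:c:]" for \<gamma>
    using X[of \<gamma> 0 0 1] by simp
  have b_power: "b ^ (m + 2) = b"
    using arg_cong[OF Xv[of 0], of "\<lambda>p. coeff p (m + 2)"]
    by (simp only: coeff_add coeff_smult cX cXv cY const) simp
  have b_next: "of_nat (m + 2) * (b ^ (m + 1) * (a * \<gamma> + c) - b ^ m * e) =
      a * (- of_nat (m + 2) * 0 ^ m) + b * (of_nat (m + 2) * 2)" for \<gamma>
    using arg_cong[OF Xv[of \<gamma>], of "\<lambda>p. coeff p (m + 1)"]
    by (simp only: coeff_add coeff_smult cX cXv cY const) simp
  \<comment> \<open>The right-hand side of \<open>b_next\<close> is free of \<gamma>, so the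
    left-hand sides at \<gamma> = 1 and \<gamma> = 0 agree.\<close>
  have "of_nat (m + 2) * (b ^ (m + 1) * a) =
      of_nat (m + 2) * (b ^ (m + 1) * (a * 1 + c) - b ^ m * e) -
      of_nat (m + 2) * (b ^ (m + 1) * (a * 0 + c) - b ^ m * e)"
    by (simp add: algebra_simps)
  also have "\<dots> = 0"
    unfolding b_next by simp
  finally have ab: "b \<noteq> 0 \<Longrightarrow> a = 0"
    using N by simp
  have "b = 0"
  proof (rule ccontr)
    assume "b \<noteq> 0"
    with ab have "a = 0" by simp
    \<comment> \<open>Leading coefficients along (t, 2 t); the right-hand side is \<open>b\<close>
      times that of \<open>evY\<close>. Cancelling \<open>b_power\<close> leaves a relation between
      powers of 2.\<close>
    have "(b * 2) ^ (m + 2) = b * 2"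
      using arg_cong[OF X[of 0 0 1 2], of "\<lambda>p. coeff p (m + 2)"]
        coeff_evY_slope2_line[of m "0 :: 'a" 1 0] \<open>a = 0\<close>
      by (simp only: coeff_add coeff_smult cX const) simp
    then have "2 ^ (m + 2) = (2 :: 'a)"
      unfolding power_mult_distrib b_power using \<open>b \<noteq> 0\<close> by simp
    then have "(2 :: nat) ^ (m + 2) = 2"
      by (metis of_nat_eq_iff of_nat_numeral of_nat_power)
    then show False
      by simp
  qed
  with det have "a \<noteq> 0" "e \<noteq> 0" by auto
  have Yv: "evY (m + 2) [:a * \<gamma> + c:] [:d * \<gamma> + f, e:] =
      smult d (evX (m + 2) [:\<gamma>:] [:0, 1:]) + smult e (evY (m + 2) [:\<gamma>:] [:0, 1:]) + [:f:]" for \<gamma>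
    using Y[of \<gamma> 0 0 1] \<open>b = 0\<close> by simp
  have e_power: "e ^ (m + 2) = e"
    using arg_cong[OF Yv[of 0], of "\<lambda>p. coeff p (m + 2)"]
    by (simp only: coeff_add coeff_smult cX cXv cY const) simp
  then have e_power': "e ^ (m + 1) = 1"
    using \<open>e \<noteq> 0\<close> by simp
  have e_next: "of_nat (m + 2) * e ^ (m + 1) * (d * \<gamma> + f + 2) =
      d * (- of_nat (m + 2) * 0 ^ m) + e * (of_nat (m + 2) * 2)" for \<gamma>
    using arg_cong[OF Yv[of \<gamma>], of "\<lambda>p. coeff p (m + 1)"]
    by (simp only: coeff_add coeff_smult cX cXv cY const) simp
  \<comment> \<open>Again only one side of \<open>e_next\<close> depends on \<gamma>.\<close>
  have "of_nat (m + 2) * d = of_nat (m + 2) * e ^ (m + 1) * (d * 1 + f + 2) -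
      of_nat (m + 2) * e ^ (m + 1) * (d * 0 + f + 2)"
    unfolding e_power' by (simp add: algebra_simps)
  also have "\<dots> = 0"
    unfolding e_next by simp
  finally have "d = 0"
    using N by simp
  have "of_nat (m + 2) * (f + 2) = of_nat (m + 2) * (2 * e)"
    using e_next[of 0, unfolded e_power' \<open>d = 0\<close>] by (simp add: mult_ac)
  then have f: "f + 2 = 2 * e"
    using N mult_left_cancel by blast
  have Xh: "evX (m + 2) [:c, a:] [:f, e * \<beta>:] = smult a (evX (m + 2) [:0, 1:] [:0, \<beta>:]) + [:c:]" for \<beta>
    using X[of 0 0 1 \<beta>] \<open>b = 0\<close> \<open>d = 0\<close> by simp
  have a_power: "a ^ (m + 2) = a"
    using arg_cong[OF Xh[of 0], of "\<lambda>p. coeff p (m + 2)"]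
    by (simp only: coeff_add coeff_smult cX const) simp
  then have a_power': "a ^ (m + 1) = 1"
    using \<open>a \<noteq> 0\<close> by simp
  have a_next: "of_nat (m + 2) * (a ^ (m + 1) * c - a ^ m * (e * \<beta>)) =
      of_nat (m + 2) * (- (a * \<beta>))" for \<beta>
    using arg_cong[OF Xh[of \<beta>], of "\<lambda>p. coeff p (m + 1)"]
    by (simp only: coeff_add coeff_smult cX const) simp
  have ac: "a ^ (m + 1) * c - a ^ m * (e * \<beta>) = - (a * \<beta>)" for \<beta>
    using a_next[of \<beta>] N mult_left_cancel by blast
  have "c = 0"
    using ac[of 0, unfolded a_power'] by simp
  have "a ^ m * e = a"
    using ac[of 1] \<open>c = 0\<close> by simp
  then have "a ^ (m + 1) * e = a * a"
    by (simp add: mult.assoc)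
  then have e: "e = a\<^sup>2"
    unfolding a_power' by (simp add: power2_eq_square)
  have "evY (m + 2) [:a * \<gamma>:] [:f, e:] = smult e (evY (m + 2) [:\<gamma>:] [:0, 1:]) + [:f:]" for \<gamma>
    using Yv[of \<gamma>] \<open>c = 0\<close> \<open>d = 0\<close> by simp
  \<comment> \<open>Subtracting the case \<gamma> = 0 from \<gamma> = 1 removes the unknown
    coefficients of \<open>evY\<close> at \<open>x\<close> = 0, and also the constant
    \<open>f\<close>, which would appear when m = 0.\<close>
  then have "coeff (evY (m + 2) [:a * 1:] [:f, e:]) m - coeff (evY (m + 2) [:a * 0:] [:f, e:]) m =
      e * (coeff (evY (m + 2) [:1:] [:0, 1:]) m - coeff (evY (m + 2) [:0:] [:0, 1:]) m)"
    by (simp only: coeff_add coeff_smult) (simp add: algebra_simps)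
  then have "of_nat (m + 2) * (a\<^sup>2 * e ^ m) = of_nat (m + 2) * e"
    by (simp only: coeff_evY_vertical_diff) (simp add: algebra_simps del: mult_cancel_left)
  then have "a\<^sup>2 * e ^ m = e"
    using N mult_left_cancel by blast
  \<comment> \<open>Since a^2 = e, the last equation reads e^(m+1) = e, whereas
    \<open>e_power'\<close> gives e^(m+1) = 1.\<close>
  then have "e = 1"
    using e e_power' by (metis Suc_eq_plus1 power_Suc)
  then show ?thesis
    using \<open>b = 0\<close> \<open>c = 0\<close> \<open>d = 0\<close> e f by auto
qed

section \<open>Determination of the automorphism group\<close>

lemma carrier_Aut_group:
  "carrier (Aut_group B) = {\<phi> \<in> affine_automorphisms. B \<circ> \<phi> = \<phi> \<circ> B}"
  by (auto simp: Aut_group_def Aut_commute_iff)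

lemma reflection_affine: "(\<lambda>(x, y). (- x, y)) \<in> (affine_automorphisms :: ('a::field \<times> 'a \<Rightarrow> _) set)"
  unfolding affine_automorphisms_def
  by (rule CollectI, rule exI[of _ "- 1"], rule exI[of _ 0], rule exI[of _ 0],
      rule exI[of _ 0], rule exI[of _ 1], rule exI[of _ 0]) auto

lemma reflection_commutes_iff:
  assumes "n \<ge> 2"
  shows "folding_map n \<circ> (\<lambda>(x, y). (- x, y)) =
      (\<lambda>(x, y). (- x :: 'a::field_char_0, y)) \<circ> folding_map n \<longleftrightarrow> odd n" (is "?L \<longleftrightarrow> _")
proof
  assume ?L
  then have L: "folding_map n \<circ> (\<lambda>(x, y). ((- 1 :: 'a) * x + 0 * y + 0, 0 * x + 1 * y + 0)) =
      (\<lambda>(x, y). (- 1 * x + 0 * y + 0, 0 * x + 1 * y + 0)) \<circ> folding_map n"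
    by simp
  obtain m where n: "n = m + 2"
    using assms by (metis add.commute le_Suc_ex)
  \<comment> \<open>Leading coefficients of \<open>evX\<close> along the line (t, 0) and along its
    reflection (-t, 0).\<close>
  have "(- 1 :: 'a) ^ n = - 1"
    using arg_cong[OF commuting_affine_on_lines(1)[OF L, of 0 0 1 0], of "\<lambda>p. coeff p n"]
      coeff_evX_line[of m "0 :: 'a" 1 0 0] coeff_evX_line[of m "0 :: 'a" "- 1" 0 0]
    by (auto simp: n)
  then show "odd n"
    by (metis one_neq_neg_one power_minus_even power_one)
next
  assume "odd n"
  then show ?L
    by (auto simp: folding_map_def evX_uminus evY_uminus)
qed

lemma carrier_Aut_group_folding_map:
  assumes "n \<ge> 2"
  shows "carrier (Aut_group (folding_map n :: 'a::field_char_0 \<times> 'a \<Rightarrow> _)) =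
    (if odd n then {id, \<lambda>(x, y). (- x, y)} else {id})"
proof -
  define r :: "'a \<times> 'a \<Rightarrow> 'a \<times> 'a" where "r = (\<lambda>(x, y). (- x, y))"
  define C where "C = carrier (Aut_group (folding_map n :: 'a \<times> 'a \<Rightarrow> _))"
  have "\<phi> \<in> {id, r}" if "\<phi> \<in> C" for \<phi>
  proof -
    from that obtain a b c d e f where det: "a * e - b * d \<noteq> 0"
      and \<phi>: "\<phi> = (\<lambda>(x, y). (a * x + b * y + c, d * x + e * y + f))"
      and comm: "folding_map n \<circ> \<phi> = \<phi> \<circ> folding_map n"
      unfolding C_def carrier_Aut_group affine_automorphisms_def by auto
    show ?thesis
      using commuting_affine_cases[OF comm[unfolded \<phi>] det assms]
      unfolding \<phi> r_def by (auto simp: power2_eq_1_iff)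
  qed
  then have "C \<subseteq> {id, r}"
    by (rule subsetI)
  moreover have "id \<in> C"
    by (simp add: C_def carrier_Aut_group id_affine)
  moreover have "r \<in> C \<longleftrightarrow> odd n"
    unfolding C_def carrier_Aut_group r_def
    using reflection_affine reflection_commutes_iff[OF assms] by auto
  ultimately have "C = (if odd n then {id, r} else {id})"
    by (cases "odd n") auto
  then show ?thesis
    unfolding C_def r_def .
qed

lemma reflection_neq_id: "(\<lambda>(x, y). (- x, y)) \<noteq> (id :: 'a::field_char_0 \<times> 'a \<Rightarrow> _)"
proof
  assume "(\<lambda>(x, y). (- x, y)) = (id :: 'a \<times> 'a \<Rightarrow> _)"
  from fun_cong[OF this, of "(1, 0)"] show False
    by simp
qed

theorem theorem3p2:
  fixes n :: nat
    and B :: "'a::{alg_closed_field, field_char_0} \<times> 'a \<Rightarrow> 'a \<times> 'a"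
  assumes "B = folding_map n" and "n \<ge> 2"
  shows "(odd n \<longrightarrow>
            Aut_group B \<cong> integer_mod_group 2 \<and>
            carrier (Aut_group B) - {\<one>\<^bsub>Aut_group B\<^esub>} = {\<lambda>(x, y). (- x, y)}) \<and>
         (even n \<longrightarrow> trivial_group (Aut_group B))"
proof (intro conjI impI)
  have one: "\<one>\<^bsub>Aut_group B\<^esub> = id"
    by (simp add: Aut_group_def)
  note carrier = carrier_Aut_group_folding_map[OF assms(2), where 'a = 'a, folded assms(1)]
  {
    assume "even n"
    with carrier one group_Aut_group show "trivial_group (Aut_group B)"
      by (simp add: trivial_group_def)
  }
  assume "odd n"
  then show "carrier (Aut_group B) - {\<one>\<^bsub>Aut_group B\<^esub>} = {\<lambda>(x, y). (- x, y)}"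
    using carrier one reflection_neq_id by auto
  define r :: "'a \<times> 'a \<Rightarrow> 'a \<times> 'a" where "r = (\<lambda>(x, y). (- x, y))"
  \<comment> \<open>Only the values at the representatives 0 and 1 of the residue classes
    matter.\<close>
  define h where "h = (\<lambda>k :: int. if k = 0 then id else r)"
  have r: "r \<circ> r = id" "r \<noteq> id"
    using reflection_neq_id by (auto simp: r_def)
  have Z2: "carrier (integer_mod_group 2) = {0, 1}"
    by (auto simp: carrier_integer_mod_group)
  have "h \<in> iso (integer_mod_group 2) (Aut_group B)"
    unfolding iso_def hom_def bij_betw_def Z2
    using r \<open>odd n\<close> carrier
    by (auto simp: h_def r_def[symmetric] mult_integer_mod_group Aut_group_def)
  then show "Aut_group B \<cong> integer_mod_group 2"
    by (rule group.iso_sym[OF group_integer_mod_group is_isoI])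
qed

end
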